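(* Let $H\in(0,\frac12)\cup(\frac12,1)$, $\sigma$ an invertible $n\times n$ matrix, and let $b:\mathbb{R}^n\to\mathbb{R}^n$ satisfy: if $H>\frac12$, there is $\alpha>1-\frac1{2H}$ with $\sup_{y\ne z}\frac{|b(y)-b(z)|}{|y-z|^\alpha}<\infty$; if $H<\frac12$, $b$ is Borel measurable with at most linear growth. For $y_0\in\mathbb{R}^n$ let $Y^{y_0}$ be the solution of $dY_t=b(Y_t)dt+\sigma dB_t$, $Y_0=y_0$, with $B$ an $n$-dimensional fBm with Hurst parameter $H$. Let $K\subset\mathbb{R}^n$ be compact. Then for each $T>0$ there is $\rho>0$ such that $$\sup_{y_0\in K}\sup_{t\in[0,T]}\mathbb{E}\big[e^{\rho|Y^{y_0}_t|^2}\big]<\infty.$$ *)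

theory Defs
  imports "HOL-Probability.Probability"
begin

text \<open>Covariance function of a one-dimensional fractional Brownian motion with Hurst parameter H.\<close>
definition fbm_cov :: "real \<Rightarrow> real \<Rightarrow> real \<Rightarrow> real" where
  "fbm_cov H s t = ((\<bar>s\<bar> powr (2*H) + \<bar>t\<bar> powr (2*H) - \<bar>t - s\<bar> powr (2*H)) / 2)"

text \<open>A real random variable is Gaussian: either normally distributed with positive
  variance, or almost surely constant (degenerate Gaussian).\<close>
definition real_gaussian :: "'a measure \<Rightarrow> ('a \<Rightarrow> real) \<Rightarrow> bool" where
  "real_gaussian M X \<longleftrightarrow> X \<in> borel_measurable M \<and>
     ((\<exists>\<mu> s. s > 0 \<and> distributed M lborel X (\<lambda>x. ennreal (normal_density \<mu> s x)))
      \<or> (\<exists>c. AE \<omega> in M. X \<omega> = c))"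

text \<open>n-dimensional fractional Brownian motion (components indexed by the finite type 'n)
  on the probability space M: a centred Gaussian process with B_0 = 0, continuous paths,
  and covariance E[B^i_s B^j_t] = delta_ij * R_H(s,t).\<close>
definition is_fBm :: "real \<Rightarrow> 'a measure \<Rightarrow> (real \<Rightarrow> 'a \<Rightarrow> real ^ 'n::finite) \<Rightarrow> bool" where
  "is_fBm H M B \<longleftrightarrow>
     (\<forall>t\<ge>0. B t \<in> borel_measurable M) \<and>
     (AE \<omega> in M. B 0 \<omega> = 0 \<and> continuous_on {0..} (\<lambda>t. B t \<omega>)) \<and>
     (\<forall>(F :: (real \<times> 'n) set) c. finite F \<and> fst ` F \<subseteq> {0..} \<longrightarrow>
         real_gaussian M (\<lambda>\<omega>. \<Sum>p\<in>F. c p * (B (fst p) \<omega> $ snd p))) \<and>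
     (\<forall>t\<ge>0. \<forall>i. integrable M (\<lambda>\<omega>. B t \<omega> $ i) \<and> (\<integral>\<omega>. B t \<omega> $ i \<partial>M) = 0) \<and>
     (\<forall>s\<ge>0. \<forall>t\<ge>0. \<forall>i j. integrable M (\<lambda>\<omega>. (B s \<omega> $ i) * (B t \<omega> $ j)) \<and>
         (\<integral>\<omega>. (B s \<omega> $ i) * (B t \<omega> $ j) \<partial>M) = (if i = j then fbm_cov H s t else 0))"

text \<open>Completed natural filtration of B.\<close>
definition fbm_filtration :: "'a measure \<Rightarrow> (real \<Rightarrow> 'a \<Rightarrow> real ^ 'n::finite) \<Rightarrow> real \<Rightarrow> 'a measure" where
  "fbm_filtration M B t = sigma (space M)
     ({B s -` A \<inter> space M | s A. s \<in> {0..t} \<and> A \<in> sets borel} \<union> null_sets M)"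

text \<open>Y is a (strong) solution of dY_t = b(Y_t) dt + sigma dB_t, Y_0 = y0, on [0,infinity):
  adapted to the completed filtration of B, continuous paths, and almost surely
  Y_t = y0 + int_0^t b(Y_s) ds + sigma B_t for all t >= 0.\<close>
definition is_fSDE_solution ::
  "'a measure \<Rightarrow> (real \<Rightarrow> 'a \<Rightarrow> real ^ 'n::finite) \<Rightarrow> (real ^ 'n \<Rightarrow> real ^ 'n) \<Rightarrow>
   real ^ 'n ^ 'n \<Rightarrow> real ^ 'n \<Rightarrow> (real \<Rightarrow> 'a \<Rightarrow> real ^ 'n) \<Rightarrow> bool" where
  "is_fSDE_solution M B b \<sigma> y0 Y \<longleftrightarrow>
     (\<forall>t\<ge>0. Y t \<in> measurable (fbm_filtration M B t) borel) \<and>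
     (AE \<omega> in M. continuous_on {0..} (\<lambda>t. Y t \<omega>) \<and>
        (\<forall>t\<ge>0. ((\<lambda>s. b (Y s \<omega>)) has_integral (Y t \<omega> - y0 - \<sigma> *v B t \<omega>)) {0..t}))"

end

theory Submission
  imports Defs
begin

text \<open>Both hypotheses on b give linear growth, norm (b y) \<le> C (1 + norm y). Gronwall's lemma,
  applied path by path to Y_t = y_0 + \<integral>_0^t b(Y_s) ds + \<sigma> B_t, bounds norm Y_t by
  d + E norm B_t + F \<integral>_0^T norm B_r dr with constants uniform in y_0 \<in> K and t \<in> [0,T].
  The coordinates of B_t are centred Gaussians of variance t^(2H) \<le> T^(2H), so exp (\<kappa> (norm B_t)^2)
  has bounded expectation for small \<kappa>; Jensen's inequality on Riemann sums and Fatou's lemma carry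
  this over to exp (\<kappa> (\<integral>_0^T norm B_r dr)^2). Since (a + b + c)^2 \<le> 9 max (a^2, b^2, c^2),
  exp (\<rho> (norm Y_t)^2) is dominated by the sum of the three corresponding exponentials.\<close>

section \<open>Pathwise bounds\<close>

lemma hoelder_imp_linear_growth:
  fixes b :: "'a::real_normed_vector \<Rightarrow> 'b::real_normed_vector"
  assumes \<alpha>: "0 < \<alpha>" and hoelder: "\<And>y z. y \<noteq> z \<Longrightarrow> norm (b y - b z) \<le> L * norm (y - z) powr \<alpha>"
  obtains C where "0 \<le> C" and "\<And>y. norm (b y) \<le> C * (1 + norm y)"
proof -
  have increment: "norm (b y - b 0) \<le> \<bar>L\<bar> * (norm y + 2)" for y
  proof -
    define k where "k = nat \<lceil>norm y\<rceil> + 1"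
    have "real k = of_int \<lceil>norm y\<rceil> + 1"
      by (simp add: k_def)
    then have k: "norm y \<le> real k" "real k \<le> norm y + 2" "1 \<le> k"
      using le_of_int_ceiling[of "norm y"] of_int_ceiling_le_add_one[of "norm y"]
      by (linarith, linarith, simp add: k_def)
    define p where "p i = (real i / real k) *\<^sub>R y" for i
    have step: "norm (b (p (Suc i)) - b (p i)) \<le> \<bar>L\<bar>" for i
    proof (cases "p (Suc i) = p i")
      case False
      have "p (Suc i) - p i = (1 / real k) *\<^sub>R y"
        by (simp add: p_def scaleR_diff_left[symmetric] diff_divide_distrib[symmetric])
      then have "norm (p (Suc i) - p i) \<le> 1"
        using k by (simp add: divide_le_eq_1)
      then have "norm (p (Suc i) - p i) powr \<alpha> \<le> 1"
        using \<alpha> by (intro powr_le1) auto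
      then have "L * norm (p (Suc i) - p i) powr \<alpha> \<le> \<bar>L\<bar>"
        by (metis abs_ge_self abs_mult abs_of_nonneg mult_left_le order_trans powr_ge_zero abs_ge_zero)
      then show ?thesis
        using hoelder[OF False] by linarith
    qed simp
    have "b y - b 0 = (\<Sum>i<k. b (p (Suc i)) - b (p i))"
      using k sum_lessThan_telescope[of "\<lambda>i. b (p i)" k] by (simp add: p_def)
    then have "norm (b y - b 0) \<le> (\<Sum>i<k. norm (b (p (Suc i)) - b (p i)))"
      by (simp add: norm_sum)
    also have "\<dots> \<le> real k * \<bar>L\<bar>"
      using sum_mono[of "{..<k}", OF step] by simp
    also have "\<dots> \<le> \<bar>L\<bar> * (norm y + 2)"
      using k by (simp add: mult.commute mult_left_mono)
    finally show ?thesis .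
  qed
  show ?thesis
  proof
    show "0 \<le> 2 * \<bar>L\<bar> + norm (b 0)" by simp
    fix y
    have "norm (b y) \<le> norm (b y - b 0) + norm (b 0)"
      by (metis norm_triangle_sub add.commute)
    also have "\<dots> \<le> \<bar>L\<bar> * (norm y + 2) + norm (b 0)"
      using increment[of y] by simp
    also have "\<dots> \<le> (2 * \<bar>L\<bar> + norm (b 0)) * (1 + norm y)"
      using mult_nonneg_nonneg[of "\<bar>L\<bar>" "norm y"] mult_nonneg_nonneg[of "norm (b 0)" "norm y"]
      by (simp add: algebra_simps)
    finally show "norm (b y) \<le> (2 * \<bar>L\<bar> + norm (b 0)) * (1 + norm y)" .
  qed
qed

lemma drift_has_linear_growth:
  fixes b :: "'a::real_normed_vector \<Rightarrow> 'b::real_normed_vector"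
  assumes H: "H \<in> {0<..<1/2} \<union> {1/2<..<1}"
    and b_hoelder: "H > 1/2 \<Longrightarrow> \<exists>\<alpha> > 1 - 1/(2*H). \<exists>L. \<forall>y z. y \<noteq> z \<longrightarrow>
                       norm (b y - b z) \<le> L * norm (y - z) powr \<alpha>"
    and b_growth: "H < 1/2 \<Longrightarrow> \<exists>C. \<forall>y. norm (b y) \<le> C * (1 + norm y)"
  obtains C where "0 \<le> C" and "\<And>y. norm (b y) \<le> C * (1 + norm y)"
proof (cases "H < 1/2")
  case True
  then obtain C where C: "norm (b y) \<le> C * (1 + norm y)" for y
    using b_growth by blast
  have "C * (1 + norm y) \<le> max C 0 * (1 + norm y)" for y
    by (intro mult_right_mono) auto
  with C show ?thesis
    by (intro that[of "max C 0"]) (auto intro: order_trans)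
next
  case False
  with H b_hoelder obtain \<alpha> L where \<alpha>: "1 - 1/(2*H) < \<alpha>"
    and L: "\<And>y z. y \<noteq> z \<Longrightarrow> norm (b y - b z) \<le> L * norm (y - z) powr \<alpha>"
    by auto
  have "0 < 1 - 1/(2*H)"
    using False H by (auto simp: field_simps)
  with \<alpha> have "0 < \<alpha>"
    by linarith
  from hoelder_imp_linear_growth[OF this L] that show ?thesis
    by blast
qed

lemma gronwall_integral_bound:
  fixes u a :: "real \<Rightarrow> real"
  assumes C: "0 \<le> C" and cu: "continuous_on {0..T} u" and ca: "continuous_on {0..T} a"
    and a_nonneg: "\<And>t. t \<in> {0..T} \<Longrightarrow> 0 \<le> a t"
    and le: "\<And>t. t \<in> {0..T} \<Longrightarrow> u t \<le> a t + C * integral {0..t} u"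
    and t: "t \<in> {0..T}"
  shows "integral {0..t} u \<le> exp (C * t) * integral {0..t} a"
proof -
  have sub: "{0..t} \<subseteq> {0..T}" using t by auto
  define w where "w s = exp (- C * s) * a s" for s
  have cw: "continuous_on {0..T} w" unfolding w_def by (intro continuous_intros ca)
  define V where "V x = exp (- C * x) * integral {0..x} u - integral {0..x} w" for x
  define D where "D x = exp (- C * x) * (u x - C * integral {0..x} u - a x)" for x
  have "(V has_real_derivative D x) (at x within {0..t})" if x: "x \<in> {0..t}" for x
  proof -
    have integral_deriv: "((\<lambda>x. integral {0..x} f) has_real_derivative f x) (at x within {0..t})"
      if "continuous_on {0..T} f" for f
      using integral_has_vector_derivative[OF that, of x] x sub
        has_vector_derivative_within_subset[OF _ sub]
      by (auto simp: has_real_derivative_iff_has_vector_derivative)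
    note d1 = integral_deriv[OF cu] and d2 = integral_deriv[OF cw]
    show ?thesis
      unfolding V_def by (rule derivative_eq_intros d1 d2 | simp)+ (simp add: D_def w_def algebra_simps)
  qed
  then obtain x where x: "x \<in> {0..t}" "V t - V 0 = D x * t"
    using mvt_very_simple[of 0 t V "\<lambda>x. (*) (D x)"] t by (auto simp: has_field_derivative_def)
  have "D x \<le> 0"
    using le[of x] x sub unfolding D_def by (auto intro!: mult_nonneg_nonpos)
  then have "V t \<le> 0"
    using x t by (simp add: V_def mult_nonpos_nonneg)
  then have "exp (- C * t) * integral {0..t} u \<le> integral {0..t} w"
    by (simp add: V_def)
  also have "\<dots> \<le> integral {0..t} a"
  proof (rule integral_le)
    show "w integrable_on {0..t}" "a integrable_on {0..t}"
      using continuous_on_subset[OF cw sub] continuous_on_subset[OF ca sub]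
      by (auto intro: integrable_continuous_real)
    show "w s \<le> a s" if "s \<in> {0..t}" for s
      using that sub a_nonneg[of s] C unfolding w_def by (auto intro: mult_left_le_one_le)
  qed
  finally show ?thesis by (simp add: exp_minus field_simps)
qed

lemma integral_equation_norm_bound:
  fixes y w :: "real \<Rightarrow> 'a::euclidean_space" and b :: "'a \<Rightarrow> 'a"
  assumes C: "0 \<le> C" and growth: "\<And>x. norm (b x) \<le> C * (1 + norm x)"
    and cy: "continuous_on {0..T} y" and cw: "continuous_on {0..T} w"
    and eq: "\<And>t. t \<in> {0..T} \<Longrightarrow> ((\<lambda>s. b (y s)) has_integral (y t - y0 - w t)) {0..t}"
    and t: "t \<in> {0..T}"
  shows "norm (y t) \<le> (norm y0 + C * T) * (1 + C * exp (C * T) * T) + norm (w t)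
                        + C * exp (C * T) * integral {0..T} (\<lambda>r. norm (w r))"
proof -
  define u where "u s = norm (y s)" for s
  define a where "a s = norm y0 + C * T + norm (w s)" for s
  have T: "0 \<le> T" using t by simp
  have cu: "continuous_on {0..T} u" unfolding u_def by (intro continuous_intros cy)
  have ca: "continuous_on {0..T} a" unfolding a_def by (intro continuous_intros cw)
  have int_u: "u integrable_on {0..s}" and int_a: "a integrable_on {0..s}" if "s \<in> {0..T}" for s
    using that continuous_on_subset[OF cu] continuous_on_subset[OF ca]
    by (auto intro!: integrable_continuous_real)
  have a_nonneg: "0 \<le> a s" for s using C T by (simp add: a_def)
  have integral_ineq: "u s \<le> a s + C * integral {0..s} u" if s: "s \<in> {0..T}" for s
  proof -
    have "((\<lambda>r. C) has_integral C * s) {0..s}"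
      using has_integral_const_real[of C 0 s] s by (simp add: mult.commute)
    then have "((\<lambda>r. C + C * u r) has_integral (C * s + C * integral {0..s} u)) {0..s}"
      using int_u[OF s] by (intro has_integral_add has_integral_mult_right) auto
    moreover have "norm (b (y r)) \<le> (C + C * u r) \<bullet> 1" for r
      using growth[of "y r"] by (simp add: u_def algebra_simps)
    ultimately have "norm (y s - y0 - w s) \<le> C * s + C * integral {0..s} u"
      using has_integral_norm_bound_integral_component[OF eq[OF s]] by fastforce
    moreover have "norm (y s) \<le> norm y0 + norm (w s) + norm (y s - y0 - w s)"
    proof -
      have "norm (y s) \<le> norm (y0 + w s) + norm (y s - y0 - w s)"
        using norm_triangle_ineq[of "y0 + w s" "y s - y0 - w s"] by simp
      then show ?thesis
        using norm_triangle_ineq[of y0 "w s"] by linarith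
    qed
    ultimately show ?thesis
      using s C mult_left_mono[of s T C] by (auto simp: u_def a_def)
  qed
  have "integral {0..t} u \<le> exp (C * t) * integral {0..t} a"
    by (rule gronwall_integral_bound[OF C cu ca a_nonneg integral_ineq t])
  also have "\<dots> \<le> exp (C * T) * integral {0..T} a"
    using t C int_a[of t] int_a[of T] a_nonneg
    by (intro mult_mono integral_subset_le integral_nonneg) (auto intro: mult_left_mono)
  also have "integral {0..T} a = T * (norm y0 + C * T) + integral {0..T} (\<lambda>r. norm (w r))"
    using int_a[of T] T unfolding a_def
    by (subst integral_add) (auto intro!: integrable_continuous_real continuous_intros cw)
  finally have "C * integral {0..t} u \<le> C * (exp (C * T) * (T * (norm y0 + C * T) + integral {0..T} (\<lambda>r. norm (w r))))"
    using C by (rule mult_left_mono)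
  then show ?thesis
    using integral_ineq[OF t] by (simp add: u_def a_def algebra_simps)
qed

lemma is_fBmD:
  fixes B :: "real \<Rightarrow> 'a \<Rightarrow> real ^ 'n"
  assumes "is_fBm H M B"
  shows "0 \<le> t \<Longrightarrow> B t \<in> borel_measurable M"
    and "AE \<omega> in M. continuous_on {0..} (\<lambda>t. B t \<omega>)"
    and "finite F \<Longrightarrow> fst ` F \<subseteq> {0..} \<Longrightarrow> real_gaussian M (\<lambda>\<omega>. \<Sum>p\<in>F. c p * (B (fst p) \<omega> $ snd p))"
    and "0 \<le> t \<Longrightarrow> (\<integral>\<omega>. B t \<omega> $ i \<partial>M) = 0"
    and "0 \<le> s \<Longrightarrow> 0 \<le> t \<Longrightarrow>
           (\<integral>\<omega>. B s \<omega> $ i * B t \<omega> $ j \<partial>M) = (if i = j then fbm_cov H s t else 0)"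
  using assms unfolding is_fBm_def by (auto elim: eventually_mono)

lemma fSDE_solution_norm_bound:
  fixes B :: "real \<Rightarrow> 'a \<Rightarrow> real ^ 'n" and Y :: "real \<Rightarrow> 'a \<Rightarrow> real ^ 'n"
  assumes fBm: "is_fBm H M B" and sol: "is_fSDE_solution M B b \<sigma> y0 Y"
    and C: "0 \<le> C" and growth: "\<And>y. norm (b y) \<le> C * (1 + norm y)"
    and t: "t \<in> {0..T}" and y0: "norm y0 \<le> R"
  shows "AE \<omega> in M. norm (Y t \<omega>) \<le> (R + C * T) * (1 + C * exp (C * T) * T)
           + onorm ((*v) \<sigma>) * norm (B t \<omega>)
           + C * exp (C * T) * onorm ((*v) \<sigma>) * integral {0..T} (\<lambda>r. norm (B r \<omega>))"
proof -
  let ?s = "onorm ((*v) \<sigma>)"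
  have lin: "bounded_linear ((*v) \<sigma>)" by (rule matrix_vector_mul_bounded_linear)
  have T: "0 \<le> T" using t by simp
  have "AE \<omega> in M. continuous_on {0..} (\<lambda>t. B t \<omega>)"
    by (rule is_fBmD(2)[OF fBm])
  moreover have "AE \<omega> in M. continuous_on {0..} (\<lambda>t. Y t \<omega>) \<and>
      (\<forall>t\<ge>0. ((\<lambda>s. b (Y s \<omega>)) has_integral (Y t \<omega> - y0 - \<sigma> *v B t \<omega>)) {0..t})"
    using sol unfolding is_fSDE_solution_def by blast
  ultimately show ?thesis
  proof eventually_elim
    case (elim \<omega>)
    have cB: "continuous_on {0..T} (\<lambda>r. B r \<omega>)" and cY: "continuous_on {0..T} (\<lambda>r. Y r \<omega>)"
      using elim by (auto intro: continuous_on_subset)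
    have "norm (Y t \<omega>) \<le> (norm y0 + C * T) * (1 + C * exp (C * T) * T) + norm (\<sigma> *v B t \<omega>)
          + C * exp (C * T) * integral {0..T} (\<lambda>r. norm (\<sigma> *v B r \<omega>))"
      using elim t by (intro integral_equation_norm_bound[OF C growth cY _ _ t]
          bounded_linear.continuous_on[OF lin cB]) auto
    moreover have "integral {0..T} (\<lambda>r. norm (\<sigma> *v B r \<omega>)) \<le> integral {0..T} (\<lambda>r. ?s * norm (B r \<omega>))"
      using onorm[OF lin] cB bounded_linear.continuous_on[OF lin cB]
      by (intro integral_le integrable_continuous_real continuous_intros) auto
    then have "C * exp (C * T) * integral {0..T} (\<lambda>r. norm (\<sigma> *v B r \<omega>))
        \<le> C * exp (C * T) * ?s * integral {0..T} (\<lambda>r. norm (B r \<omega>))"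
      using C by (simp add: mult.assoc mult_left_mono)
    moreover have "norm (\<sigma> *v B t \<omega>) \<le> ?s * norm (B t \<omega>)"
      using onorm[OF lin] .
    moreover have "(norm y0 + C * T) * (1 + C * exp (C * T) * T) \<le> (R + C * T) * (1 + C * exp (C * T) * T)"
      using y0 C T by (intro mult_right_mono) auto
    ultimately show ?case
      by linarith
  qed
qed

section \<open>Riemann sums and time integrals\<close>

lemma integral_split_equal_pieces:
  fixes g :: "real \<Rightarrow> real"
  assumes "continuous_on {a..a + real m * h} g" and "0 \<le> h"
  shows "integral {a..a + real m * h} g = (\<Sum>k<m. integral {a + real k * h..a + real (Suc k) * h} g)"
  using assms(1)
proof (induction m)
  case (Suc m)
  have "{a..a + real m * h} \<subseteq> {a..a + real (Suc m) * h}"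
    using assms(2) by (auto simp: algebra_simps)
  then have "integral {a..a + real m * h} g = (\<Sum>k<m. integral {a + real k * h..a + real (Suc k) * h} g)"
    using Suc continuous_on_subset by blast
  moreover have "integral {a..a + real m * h} g + integral {a + real m * h..a + real (Suc m) * h} g
      = integral {a..a + real (Suc m) * h} g"
    using Suc.prems assms(2)
    by (intro Henstock_Kurzweil_Integration.integral_combine integrable_continuous_real) (auto simp: algebra_simps)
  ultimately show ?case by simp
qed simp

lemma left_rectangle_error_le:
  fixes g :: "real \<Rightarrow> real"
  assumes c: "continuous_on {x..x + h} g" and h: "0 \<le> h"
    and close: "\<And>y. y \<in> {x..x + h} \<Longrightarrow> \<bar>g y - g x\<bar> \<le> e"
  shows "\<bar>integral {x..x + h} g - h * g x\<bar> \<le> h * e"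
proof -
  have ig: "g integrable_on {x..x + h}"
    using c integrable_continuous_real by blast
  have "integral {x..x + h} (\<lambda>y. g y - g x) = integral {x..x + h} g - h * g x"
    using ig h by (simp add: integral_diff integrable_const_ivl)
  moreover have "norm (integral {x..x + h} (\<lambda>y. g y - g x)) \<le> integral {x..x + h} (\<lambda>y. e)"
    using ig close by (intro integral_norm_bound_integral integrable_diff) auto
  ultimately show ?thesis
    using h by simp
qed

lemma left_riemann_sum_error_le:
  fixes g :: "real \<Rightarrow> real"
  assumes c: "continuous_on {0..real n * h} g" and h: "0 \<le> h"
    and close: "\<And>x y. x \<in> {0..real n * h} \<Longrightarrow> y \<in> {0..real n * h} \<Longrightarrow> \<bar>y - x\<bar> \<le> h \<Longrightarrow> \<bar>g y - g x\<bar> \<le> e"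
  shows "\<bar>h * (\<Sum>k<n. g (real k * h)) - integral {0..real n * h} g\<bar> \<le> real n * h * e"
proof -
  have piece: "\<bar>integral {real k * h..real k * h + h} g - h * g (real k * h)\<bar> \<le> h * e"
    if k: "k < n" for k
  proof -
    have "real k * h + h \<le> real n * h"
      using k h mult_right_mono[of "real (Suc k)" "real n" h] by (simp add: algebra_simps)
    then have sub: "{real k * h..real k * h + h} \<subseteq> {0..real n * h}"
      using h by auto
    show ?thesis
    proof (rule left_rectangle_error_le)
      show "continuous_on {real k * h..real k * h + h} g"
        using c sub by (rule continuous_on_subset)
      show "\<bar>g y - g (real k * h)\<bar> \<le> e" if y: "y \<in> {real k * h..real k * h + h}" for y
        using close[of "real k * h" y] subsetD[OF sub y] subsetD[OF sub, of "real k * h"] y h by auto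
    qed (rule h)
  qed
  have "integral {0..real n * h} g = (\<Sum>k<n. integral {real k * h..real k * h + h} g)"
    using integral_split_equal_pieces[of 0 n h g] c h by (simp add: algebra_simps)
  then have "\<bar>h * (\<Sum>k<n. g (real k * h)) - integral {0..real n * h} g\<bar>
      = \<bar>\<Sum>k<n. h * g (real k * h) - integral {real k * h..real k * h + h} g\<bar>"
    by (simp only: sum_distrib_left sum_subtractf)
  also have "\<dots> \<le> (\<Sum>k<n. \<bar>h * g (real k * h) - integral {real k * h..real k * h + h} g\<bar>)"
    by (rule sum_abs)
  also have "\<dots> \<le> (\<Sum>k<n. h * e)"
    using piece by (intro sum_mono) (simp add: abs_minus_commute)
  finally show ?thesis
    by simp
qed

lemma riemann_sum_tendsto_integral:
  fixes g :: "real \<Rightarrow> real"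
  assumes c: "continuous_on {0..T} g" and T: "0 < T"
  shows "(\<lambda>m. T / real (Suc m) * (\<Sum>k<Suc m. g (real k * (T / real (Suc m)))))
           \<longlonglongrightarrow> integral {0..T} g"
proof (rule LIMSEQ_I)
  fix r :: real
  assume r: "0 < r"
  define e where "e = r / (2 * T)"
  have e: "0 < e" using r T by (simp add: e_def)
  obtain d where d: "0 < d"
    and uc: "\<And>x x'. x \<in> {0..T} \<Longrightarrow> x' \<in> {0..T} \<Longrightarrow> dist x' x < d \<Longrightarrow> dist (g x') (g x) < e"
    using compact_uniformly_continuous[OF c compact_Icc] e unfolding uniformly_continuous_on_def by metis
  obtain N :: nat where N: "T / d < real N"
    using reals_Archimedean2 by blast
  have "\<bar>T / real (Suc n) * (\<Sum>k<Suc n. g (real k * (T / real (Suc n)))) - integral {0..T} g\<bar> < r"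
    if n: "N \<le> n" for n
  proof -
    define h where "h = T / real (Suc n)"
    have "T / d < real (Suc n)"
      using N n by linarith
    then have h: "0 < h" "h < d" "real (Suc n) * h = T"
      using T d by (auto simp: h_def field_simps)
    have "\<bar>g y - g x\<bar> \<le> e" if "x \<in> {0..T}" "y \<in> {0..T}" "\<bar>y - x\<bar> \<le> h" for x y
      using uc[OF that(1,2)] that(3) h(2) by (simp add: dist_real_def)
    then have "\<bar>h * (\<Sum>k<Suc n. g (real k * h)) - integral {0..T} g\<bar> \<le> T * e"
      using left_riemann_sum_error_le[of "Suc n" h g e, unfolded h(3)] c h(1) by simp
    also have "\<dots> < r"
      using T r by (simp add: e_def)
    finally show ?thesis
      by (simp add: h_def)
  qed
  then show "\<exists>N. \<forall>n\<ge>N. norm (T / real (Suc n) * (\<Sum>k<Suc n. g (real k * (T / real (Suc n))))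
      - integral {0..T} g) < r"
    by auto
qed

lemma exp_sq_riemann_sum_le:
  fixes x :: "nat \<Rightarrow> real"
  assumes \<kappa>: "0 \<le> \<kappa>" and m: "0 < m"
  shows "exp (\<kappa> * (T / real m * (\<Sum>k<m. x k))\<^sup>2) \<le> (\<Sum>k<m. exp (\<kappa> * T\<^sup>2 * (x k)\<^sup>2) / real m)"
proof -
  have "(T / real m * (\<Sum>k<m. x k))\<^sup>2 = T\<^sup>2 / (real m)\<^sup>2 * (\<Sum>k<m. x k)\<^sup>2"
    by (simp add: power_mult_distrib power_divide)
  also have "\<dots> \<le> T\<^sup>2 / (real m)\<^sup>2 * ((\<Sum>k<m. (x k)\<^sup>2) * real m)"
    using sum_squared_le_sum_of_squares[of x "{..<m}"] by (intro mult_left_mono) (auto simp: mult.commute)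
  also have "\<dots> = (\<Sum>k<m. (1 / real m) * (T\<^sup>2 * (x k)\<^sup>2))"
    using m by (simp add: sum_distrib_left power2_eq_square field_simps)
  finally have "\<kappa> * (T / real m * (\<Sum>k<m. x k))\<^sup>2 \<le> \<kappa> * (\<Sum>k<m. (1 / real m) * (T\<^sup>2 * (x k)\<^sup>2))"
    using \<kappa> by (rule mult_left_mono)
  also have "\<dots> = (\<Sum>k<m. (1 / real m) *\<^sub>R (\<kappa> * T\<^sup>2 * (x k)\<^sup>2))"
    by (simp add: sum_distrib_left algebra_simps)
  finally have "exp (\<kappa> * (T / real m * (\<Sum>k<m. x k))\<^sup>2)
      \<le> exp (\<Sum>k<m. (1 / real m) *\<^sub>R (\<kappa> * T\<^sup>2 * (x k)\<^sup>2))"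
    by simp
  also have "\<dots> \<le> (\<Sum>k<m. (1 / real m) * exp (\<kappa> * T\<^sup>2 * (x k)\<^sup>2))"
    using convex_on_sum[OF _ _ exp_convex, of "{..<m}" "\<lambda>k. 1 / real m" "\<lambda>k. \<kappa> * T\<^sup>2 * (x k)\<^sup>2"] m
    by auto
  finally show ?thesis
    by simp
qed

lemma nn_integral_average_le:
  fixes f :: "nat \<Rightarrow> 'a \<Rightarrow> ennreal"
  assumes m: "0 < m" and meas: "\<And>k. k < m \<Longrightarrow> f k \<in> borel_measurable M"
    and bound: "\<And>k. k < m \<Longrightarrow> (\<integral>\<^sup>+\<omega>. f k \<omega> \<partial>M) \<le> c"
  shows "(\<integral>\<^sup>+\<omega>. (\<Sum>k<m. ennreal (1 / real m) * f k \<omega>) \<partial>M) \<le> c"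
proof -
  have "(\<integral>\<^sup>+\<omega>. (\<Sum>k<m. ennreal (1 / real m) * f k \<omega>) \<partial>M)
      = (\<Sum>k<m. \<integral>\<^sup>+\<omega>. ennreal (1 / real m) * f k \<omega> \<partial>M)"
    using meas by (intro nn_integral_sum) auto
  also have "\<dots> = (\<Sum>k<m. ennreal (1 / real m) * (\<integral>\<^sup>+\<omega>. f k \<omega> \<partial>M))"
    using meas by (intro sum.cong refl nn_integral_cmult) auto
  also have "\<dots> \<le> (\<Sum>k<m. ennreal (1 / real m) * c)"
    using bound by (intro sum_mono mult_left_mono) auto
  also have "\<dots> = c"
    using m by (simp add: ennreal_of_nat_eq_real_of_nat mult.assoc[symmetric] ennreal_mult[symmetric])
  finally show ?thesis .
qed

lemma nn_integral_liminf_majorant: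
  fixes f :: "nat \<Rightarrow> 'a \<Rightarrow> ennreal"
  assumes meas: "\<And>m. f m \<in> borel_measurable M" and bound: "\<And>m. (\<integral>\<^sup>+\<omega>. f m \<omega> \<partial>M) \<le> c"
    and le: "AE \<omega> in M. g \<omega> \<le> liminf (\<lambda>m. f m \<omega>)"
  obtains \<Phi> where "\<Phi> \<in> borel_measurable M" and "AE \<omega> in M. g \<omega> \<le> \<Phi> \<omega>" and "(\<integral>\<^sup>+\<omega>. \<Phi> \<omega> \<partial>M) \<le> c"
proof (rule that[of "\<lambda>\<omega>. liminf (\<lambda>m. f m \<omega>)"])
  show "(\<lambda>\<omega>. liminf (\<lambda>m. f m \<omega>)) \<in> borel_measurable M"
    by (rule borel_measurable_liminf[OF meas])
  have "(\<integral>\<^sup>+\<omega>. liminf (\<lambda>m. f m \<omega>) \<partial>M) \<le> liminf (\<lambda>m. \<integral>\<^sup>+\<omega>. f m \<omega> \<partial>M)"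
    by (rule nn_integral_liminf[OF meas])
  also have "\<dots> \<le> c"
    using Liminf_mono[of "\<lambda>m. \<integral>\<^sup>+\<omega>. f m \<omega> \<partial>M" "\<lambda>m. c" sequentially] bound
    by (simp add: Liminf_const)
  finally show "(\<integral>\<^sup>+\<omega>. liminf (\<lambda>m. f m \<omega>) \<partial>M) \<le> c" .
qed (rule le)

lemma nn_integral_exp_sq_path_integral_le:
  fixes X :: "real \<Rightarrow> 'a \<Rightarrow> real"
  assumes T: "0 < T" and \<kappa>: "0 \<le> \<kappa>"
    and meas: "\<And>t. t \<in> {0..T} \<Longrightarrow> X t \<in> borel_measurable M"
    and cont: "AE \<omega> in M. continuous_on {0..T} (\<lambda>t. X t \<omega>)"
    and moment: "\<And>t. t \<in> {0..T} \<Longrightarrow> (\<integral>\<^sup>+\<omega>. ennreal (exp (\<kappa> * T\<^sup>2 * (X t \<omega>)\<^sup>2)) \<partial>M) \<le> c"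
  obtains \<Phi> where "\<Phi> \<in> borel_measurable M"
    and "AE \<omega> in M. ennreal (exp (\<kappa> * (integral {0..T} (\<lambda>t. X t \<omega>))\<^sup>2)) \<le> \<Phi> \<omega>"
    and "(\<integral>\<^sup>+\<omega>. \<Phi> \<omega> \<partial>M) \<le> c"
proof -
  define tk where "tk m k = real k * (T / real (Suc m))" for m k :: nat
  have tk: "tk m k \<in> {0..T}" if "k < Suc m" for m k
  proof -
    have "real k * T \<le> real (Suc m) * T"
      using that T by (intro mult_right_mono) auto
    then show ?thesis
      using T by (simp add: tk_def field_simps)
  qed
  have f_meas: "(\<lambda>\<omega>. ennreal (exp (\<kappa> * T\<^sup>2 * (X t \<omega>)\<^sup>2))) \<in> borel_measurable M" if "t \<in> {0..T}" for t
    using meas[OF that] by measurable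
  define G where "G m \<omega> = (\<Sum>k<Suc m. ennreal (1 / real (Suc m)) * ennreal (exp (\<kappa> * T\<^sup>2 * (X (tk m k) \<omega>)\<^sup>2)))"
    for m \<omega>
  show ?thesis
  proof (rule nn_integral_liminf_majorant[of G])
    show "G m \<in> borel_measurable M" for m
      unfolding G_def using f_meas tk by (intro borel_measurable_sum borel_measurable_times_ennreal) auto
    show "(\<integral>\<^sup>+\<omega>. G m \<omega> \<partial>M) \<le> c" for m
      unfolding G_def using f_meas moment tk by (intro nn_integral_average_le) auto
    show "AE \<omega> in M. ennreal (exp (\<kappa> * (integral {0..T} (\<lambda>t. X t \<omega>))\<^sup>2)) \<le> liminf (\<lambda>m. G m \<omega>)"
      using cont
    proof eventually_elim
      case (elim \<omega>)
      define R where "R m = T / real (Suc m) * (\<Sum>k<Suc m. X (tk m k) \<omega>)" for m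
      have "R \<longlonglongrightarrow> integral {0..T} (\<lambda>t. X t \<omega>)"
        unfolding R_def tk_def by (rule riemann_sum_tendsto_integral[OF elim T])
      then have "(\<lambda>m. ennreal (exp (\<kappa> * (R m)\<^sup>2))) \<longlonglongrightarrow> ennreal (exp (\<kappa> * (integral {0..T} (\<lambda>t. X t \<omega>))\<^sup>2))"
        by (intro tendsto_ennrealI tendsto_intros)
      then have "ennreal (exp (\<kappa> * (integral {0..T} (\<lambda>t. X t \<omega>))\<^sup>2)) = liminf (\<lambda>m. ennreal (exp (\<kappa> * (R m)\<^sup>2)))"
        by (intro lim_imp_Liminf[symmetric]) auto
      also have "\<dots> \<le> liminf (\<lambda>m. G m \<omega>)"
      proof (intro Liminf_mono always_eventually allI)
        fix m
        have "exp (\<kappa> * (R m)\<^sup>2) \<le> (\<Sum>k<Suc m. exp (\<kappa> * T\<^sup>2 * (X (tk m k) \<omega>)\<^sup>2) / real (Suc m))"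
          unfolding R_def by (rule exp_sq_riemann_sum_le[OF \<kappa>]) simp
        then have "ennreal (exp (\<kappa> * (R m)\<^sup>2))
            \<le> ennreal (\<Sum>k<Suc m. exp (\<kappa> * T\<^sup>2 * (X (tk m k) \<omega>)\<^sup>2) / real (Suc m))"
          by (rule ennreal_leI)
        also have "\<dots> = G m \<omega>"
          unfolding G_def by (subst sum_ennreal[symmetric]) (auto intro!: sum.cong simp: ennreal_mult[symmetric])
        finally show "ennreal (exp (\<kappa> * (R m)\<^sup>2)) \<le> G m \<omega>" .
      qed
      finally show ?case .
    qed
  qed (rule that)
qed

section \<open>Gaussian exponential moments\<close>

lemma normal_density_mult_exp_sq_le:
  fixes s x \<kappa> :: real
  assumes s: "0 < s" and \<kappa>: "4 * \<kappa> * s\<^sup>2 \<le> 1"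
  shows "normal_density 0 s x * exp (\<kappa> * x\<^sup>2) \<le> sqrt 2 * normal_density 0 (sqrt 2 * s) x"
proof -
  have "\<kappa> * x\<^sup>2 \<le> x\<^sup>2 / (4 * s\<^sup>2)"
    using mult_right_mono[of \<kappa> "1 / (4 * s\<^sup>2)" "x\<^sup>2"] \<kappa> s by (simp add: field_simps)
  moreover have "- x\<^sup>2 / (2 * (sqrt 2 * s)\<^sup>2) = - x\<^sup>2 / (2 * s\<^sup>2) + x\<^sup>2 / (4 * s\<^sup>2)"
    using s by (simp add: power_mult_distrib field_simps)
  ultimately have "- x\<^sup>2 / (2 * s\<^sup>2) + \<kappa> * x\<^sup>2 \<le> - x\<^sup>2 / (2 * (sqrt 2 * s)\<^sup>2)"
    by linarith
  then have "normal_density 0 s x * exp (\<kappa> * x\<^sup>2)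
      \<le> 1 / sqrt (2 * pi * s\<^sup>2) * exp (- x\<^sup>2 / (2 * (sqrt 2 * s)\<^sup>2))"
    unfolding normal_density_def by (simp add: mult.assoc exp_add[symmetric] divide_right_mono)
  also have "1 / sqrt (2 * pi * s\<^sup>2) = sqrt 2 * (1 / sqrt (2 * pi * (sqrt 2 * s)\<^sup>2))"
    using s by (simp add: power_mult_distrib real_sqrt_mult field_simps)
  finally show ?thesis
    by (simp add: normal_density_def mult.assoc)
qed

lemma real_gaussian_nn_integral_exp_sq_le:
  fixes X :: "'a \<Rightarrow> real"
  assumes P: "prob_space M" and G: "real_gaussian M X"
    and mean: "(\<integral>\<omega>. X \<omega> \<partial>M) = 0" and \<kappa>: "4 * \<kappa> * (\<integral>\<omega>. (X \<omega>)\<^sup>2 \<partial>M) \<le> 1"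
  shows "(\<integral>\<^sup>+\<omega>. ennreal (exp (\<kappa> * (X \<omega>)\<^sup>2)) \<partial>M) \<le> 2"
proof -
  interpret prob_space M by (rule P)
  consider (normal) \<mu> s where "0 < s" "distributed M lborel X (\<lambda>x. ennreal (normal_density \<mu> s x))"
    | (degenerate) c where "AE \<omega> in M. X \<omega> = c"
    using G unfolding real_gaussian_def by blast
  then show ?thesis
  proof cases
    case (normal \<mu> s)
    have \<mu>: "\<mu> = 0"
      using normal_distributed_expectation[OF normal] mean by simp
    have "s\<^sup>2 = (\<integral>\<omega>. (X \<omega>)\<^sup>2 \<partial>M)"
      using normal_distributed_variance[OF normal] mean by simp
    then have pointwise: "normal_density 0 s x * exp (\<kappa> * x\<^sup>2) \<le> sqrt 2 * normal_density 0 (sqrt 2 * s) x" for x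
      using normal(1) \<kappa> by (intro normal_density_mult_exp_sq_le) auto
    have "(\<integral>\<^sup>+\<omega>. ennreal (exp (\<kappa> * (X \<omega>)\<^sup>2)) \<partial>M)
        = (\<integral>\<^sup>+x. ennreal (normal_density 0 s x) * ennreal (exp (\<kappa> * x\<^sup>2)) \<partial>lborel)"
      using distributed_nn_integral[of M lborel X _ "\<lambda>x. ennreal (exp (\<kappa> * x\<^sup>2))"] normal(2) \<mu> by simp
    also have "\<dots> \<le> (\<integral>\<^sup>+x. ennreal (sqrt 2) * ennreal (normal_density 0 (sqrt 2 * s) x) \<partial>lborel)"
      using pointwise by (intro nn_integral_mono) (simp add: ennreal_mult[symmetric] ennreal_leI)
    also have "\<dots> = ennreal (sqrt 2) * (\<integral>\<^sup>+x. ennreal (normal_density 0 (sqrt 2 * s) x) \<partial>lborel)"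
      by (rule nn_integral_cmult) simp
    also have "(\<integral>\<^sup>+x. ennreal (normal_density 0 (sqrt 2 * s) x) \<partial>lborel) = 1"
      using normal(1) by (subst nn_integral_eq_integral) (auto simp: integrable_normal_density integral_normal_density)
    also have "ennreal (sqrt 2) * 1 \<le> 2"
      using real_sqrt_le_iff[of 2 4] by (simp add: ennreal_leI[where y=2, simplified])
    finally show ?thesis .
  next
    case (degenerate c)
    have "X \<in> borel_measurable M"
      using G unfolding real_gaussian_def by blast
    then have "c = 0"
      using mean integral_cong_AE[of X M "\<lambda>_. c"] degenerate by (simp add: prob_space)
    then have "(\<integral>\<^sup>+\<omega>. ennreal (exp (\<kappa> * (X \<omega>)\<^sup>2)) \<partial>M) = (\<integral>\<^sup>+\<omega>. 1 \<partial>M)"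
      using degenerate by (intro nn_integral_cong_AE) auto
    then show ?thesis
      by (simp add: emeasure_space_1)
  qed
qed

lemma norm_sq_le_card_mult_component_sq:
  fixes x :: "real ^ 'n"
  obtains j where "(norm x)\<^sup>2 \<le> CARD('n) * (x $ j)\<^sup>2"
proof -
  have "Max (range (\<lambda>i. (x $ i)\<^sup>2)) \<in> range (\<lambda>i. (x $ i)\<^sup>2)"
    by (intro Max_in) auto
  then obtain j where j_max: "Max (range (\<lambda>i. (x $ i)\<^sup>2)) = (x $ j)\<^sup>2"
    by (rule rangeE)
  have j: "(x $ i)\<^sup>2 \<le> (x $ j)\<^sup>2" for i
    unfolding j_max[symmetric] by (rule Max_ge) auto
  have "(norm x)\<^sup>2 = (\<Sum>i\<in>UNIV. (x $ i)\<^sup>2)"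
    unfolding power2_norm_eq_inner inner_vec_def by (simp add: power2_eq_square)
  also have "\<dots> \<le> CARD('n) * (x $ j)\<^sup>2"
    using sum_mono[of UNIV "\<lambda>i. (x $ i)\<^sup>2" "\<lambda>_. (x $ j)\<^sup>2"] j by simp
  finally show ?thesis
    using that by blast
qed

lemma nn_integral_exp_norm_sq_le_sum_components:
  fixes X :: "'a \<Rightarrow> real ^ 'n"
  assumes X: "X \<in> borel_measurable M" and \<kappa>: "0 \<le> \<kappa>"
  shows "(\<integral>\<^sup>+\<omega>. ennreal (exp (\<kappa> * (norm (X \<omega>))\<^sup>2)) \<partial>M)
           \<le> (\<Sum>i\<in>UNIV. \<integral>\<^sup>+\<omega>. ennreal (exp (\<kappa> * CARD('n) * (X \<omega> $ i)\<^sup>2)) \<partial>M)"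
proof -
  have [measurable]: "(\<lambda>\<omega>. X \<omega> $ i) \<in> borel_measurable M" for i
    using measurable_compose[OF X borel_measurable_nth] .
  have "ennreal (exp (\<kappa> * (norm (X \<omega>))\<^sup>2)) \<le> (\<Sum>i\<in>UNIV. ennreal (exp (\<kappa> * CARD('n) * (X \<omega> $ i)\<^sup>2)))" for \<omega>
  proof -
    obtain j where "(norm (X \<omega>))\<^sup>2 \<le> CARD('n) * (X \<omega> $ j)\<^sup>2"
      by (rule norm_sq_le_card_mult_component_sq)
    then have "ennreal (exp (\<kappa> * (norm (X \<omega>))\<^sup>2)) \<le> ennreal (exp (\<kappa> * CARD('n) * (X \<omega> $ j)\<^sup>2))"
      using mult_left_mono[OF _ \<kappa>] by (intro ennreal_leI) (simp add: mult.assoc)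
    also have "\<dots> \<le> (\<Sum>i\<in>UNIV. ennreal (exp (\<kappa> * CARD('n) * (X \<omega> $ i)\<^sup>2)))"
      by (rule member_le_sum) auto
    finally show ?thesis .
  qed
  then have "(\<integral>\<^sup>+\<omega>. ennreal (exp (\<kappa> * (norm (X \<omega>))\<^sup>2)) \<partial>M)
      \<le> (\<integral>\<^sup>+\<omega>. (\<Sum>i\<in>UNIV. ennreal (exp (\<kappa> * CARD('n) * (X \<omega> $ i)\<^sup>2))) \<partial>M)"
    by (intro nn_integral_mono)
  also have "\<dots> = (\<Sum>i\<in>UNIV. \<integral>\<^sup>+\<omega>. ennreal (exp (\<kappa> * CARD('n) * (X \<omega> $ i)\<^sup>2)) \<partial>M)"
    by (intro nn_integral_sum) measurable
  finally show ?thesis .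
qed

lemma is_fBm_component:
  fixes B :: "real \<Rightarrow> 'a \<Rightarrow> real ^ 'n"
  assumes fBm: "is_fBm H M B" and t: "0 \<le> t"
  shows "real_gaussian M (\<lambda>\<omega>. B t \<omega> $ i)" and "(\<integral>\<omega>. B t \<omega> $ i \<partial>M) = 0"
    and "(\<integral>\<omega>. (B t \<omega> $ i)\<^sup>2 \<partial>M) = t powr (2 * H)"
proof -
  show "real_gaussian M (\<lambda>\<omega>. B t \<omega> $ i)"
    using is_fBmD(3)[OF fBm, of "{(t, i)}" "\<lambda>_. 1"] t by simp
  show "(\<integral>\<omega>. B t \<omega> $ i \<partial>M) = 0"
    using is_fBmD(4)[OF fBm t] .
  show "(\<integral>\<omega>. (B t \<omega> $ i)\<^sup>2 \<partial>M) = t powr (2 * H)"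
    using is_fBmD(5)[OF fBm t t, of i i] t by (simp add: fbm_cov_def power2_eq_square)
qed

lemma fbm_nn_integral_exp_norm_sq_le:
  fixes B :: "real \<Rightarrow> 'a \<Rightarrow> real ^ 'n" and \<kappa> :: real
  assumes P: "prob_space M" and fBm: "is_fBm H M B" and H: "0 < H" and t: "t \<in> {0..T}"
    and \<kappa>: "0 \<le> \<kappa>" "4 * \<kappa> * CARD('n) * T powr (2 * H) \<le> 1"
  shows "(\<integral>\<^sup>+\<omega>. ennreal (exp (\<kappa> * (norm (B t \<omega>))\<^sup>2)) \<partial>M) \<le> 2 * of_nat CARD('n)"
proof -
  have "B t \<in> borel_measurable M"
    using is_fBmD(1)[OF fBm] t by simp
  then have "(\<integral>\<^sup>+\<omega>. ennreal (exp (\<kappa> * (norm (B t \<omega>))\<^sup>2)) \<partial>M)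
      \<le> (\<Sum>i\<in>UNIV. \<integral>\<^sup>+\<omega>. ennreal (exp (\<kappa> * CARD('n) * (B t \<omega> $ i)\<^sup>2)) \<partial>M)"
    using \<kappa>(1) by (rule nn_integral_exp_norm_sq_le_sum_components)
  also have "\<dots> \<le> (\<Sum>i\<in>(UNIV :: 'n set). 2)"
  proof (intro sum_mono real_gaussian_nn_integral_exp_sq_le[OF P])
    fix i
    have t0: "0 \<le> t" using t by simp
    show "real_gaussian M (\<lambda>\<omega>. B t \<omega> $ i)" "(\<integral>\<omega>. B t \<omega> $ i \<partial>M) = 0"
      using is_fBm_component[OF fBm t0] by blast+
    have "t powr (2 * H) \<le> T powr (2 * H)"
      using t H by (intro powr_mono2) auto
    then have "4 * (\<kappa> * CARD('n)) * t powr (2 * H) \<le> 4 * \<kappa> * CARD('n) * T powr (2 * H)"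
      using \<kappa>(1) by (simp add: mult.assoc mult_left_mono)
    then show "4 * (\<kappa> * CARD('n)) * (\<integral>\<omega>. (B t \<omega> $ i)\<^sup>2 \<partial>M) \<le> 1"
      using is_fBm_component(3)[OF fBm t0] \<kappa>(2) by simp
  qed
  also have "\<dots> = 2 * of_nat CARD('n)"
    by (simp add: mult.commute)
  finally show ?thesis .
qed

section \<open>Exponential moments of the solution\<close>

lemma exp_sq_add3_le:
  fixes a b c \<rho> :: real
  assumes \<rho>: "0 \<le> \<rho>"
  shows "exp (\<rho> * (a + b + c)\<^sup>2) \<le> exp (9 * \<rho> * a\<^sup>2) + exp (9 * \<rho> * b\<^sup>2) + exp (9 * \<rho> * c\<^sup>2)"
proof -
  have "(a + b + c)\<^sup>2 \<le> 3 * (a\<^sup>2 + b\<^sup>2 + c\<^sup>2)"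
    using sum_squares_ge_zero[of "a - b" "b - c"] zero_le_power2[of "a - c"]
    by (simp add: power2_eq_square algebra_simps)
  then consider (a) "(a + b + c)\<^sup>2 \<le> 9 * a\<^sup>2" | (b) "(a + b + c)\<^sup>2 \<le> 9 * b\<^sup>2" | (c) "(a + b + c)\<^sup>2 \<le> 9 * c\<^sup>2"
    by (smt (verit))
  moreover have le: "exp (\<rho> * (a + b + c)\<^sup>2) \<le> exp (9 * \<rho> * u\<^sup>2)" if "(a + b + c)\<^sup>2 \<le> 9 * u\<^sup>2" for u
    using mult_left_mono[OF that \<rho>] by (simp add: algebra_simps)
  moreover have pos: "0 < exp (9 * \<rho> * a\<^sup>2)" "0 < exp (9 * \<rho> * b\<^sup>2)" "0 < exp (9 * \<rho> * c\<^sup>2)"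
    by simp_all
  ultimately show ?thesis
  proof cases
    case a
    show ?thesis using le[OF a] pos by linarith
  next
    case b
    show ?thesis using le[OF b] pos by linarith
  next
    case c
    show ?thesis using le[OF c] pos by linarith
  qed
qed

lemma nn_integral_exp_sq_affine_le:
  assumes P: "prob_space M" and \<rho>: "0 \<le> \<rho>"
    and bound: "AE \<omega> in M. z \<omega> \<le> d + x \<omega> + s \<omega>" and z: "\<And>\<omega>. 0 \<le> z \<omega>"
    and x: "x \<in> borel_measurable M"
    and \<Phi>: "\<Phi> \<in> borel_measurable M" "AE \<omega> in M. ennreal (exp (9 * \<rho> * (s \<omega>)\<^sup>2)) \<le> \<Phi> \<omega>"
  shows "(\<integral>\<^sup>+\<omega>. ennreal (exp (\<rho> * (z \<omega>)\<^sup>2)) \<partial>M)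
           \<le> ennreal (exp (9 * \<rho> * d\<^sup>2)) + (\<integral>\<^sup>+\<omega>. ennreal (exp (9 * \<rho> * (x \<omega>)\<^sup>2)) \<partial>M) + (\<integral>\<^sup>+\<omega>. \<Phi> \<omega> \<partial>M)"
proof -
  interpret prob_space M by (rule P)
  have "AE \<omega> in M. ennreal (exp (\<rho> * (z \<omega>)\<^sup>2))
      \<le> ennreal (exp (9 * \<rho> * d\<^sup>2)) + ennreal (exp (9 * \<rho> * (x \<omega>)\<^sup>2)) + \<Phi> \<omega>"
    using bound \<Phi>(2)
  proof eventually_elim
    case (elim \<omega>)
    have "(z \<omega>)\<^sup>2 \<le> (d + x \<omega> + s \<omega>)\<^sup>2"
      using elim(1) z by (intro power_mono) auto
    then have "exp (\<rho> * (z \<omega>)\<^sup>2) \<le> exp (\<rho> * (d + x \<omega> + s \<omega>)\<^sup>2)"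
      using \<rho> by (simp add: mult_left_mono)
    also have "\<dots> \<le> exp (9 * \<rho> * d\<^sup>2) + exp (9 * \<rho> * (x \<omega>)\<^sup>2) + exp (9 * \<rho> * (s \<omega>)\<^sup>2)"
      by (rule exp_sq_add3_le[OF \<rho>])
    finally have "ennreal (exp (\<rho> * (z \<omega>)\<^sup>2))
        \<le> ennreal (exp (9 * \<rho> * d\<^sup>2)) + ennreal (exp (9 * \<rho> * (x \<omega>)\<^sup>2)) + ennreal (exp (9 * \<rho> * (s \<omega>)\<^sup>2))"
      by (simp add: ennreal_plus[symmetric] ennreal_leI del: ennreal_plus)
    also have "\<dots> \<le> ennreal (exp (9 * \<rho> * d\<^sup>2)) + ennreal (exp (9 * \<rho> * (x \<omega>)\<^sup>2)) + \<Phi> \<omega>"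
      using elim(2) by (rule add_left_mono)
    finally show ?case .
  qed
  then have "(\<integral>\<^sup>+\<omega>. ennreal (exp (\<rho> * (z \<omega>)\<^sup>2)) \<partial>M)
      \<le> (\<integral>\<^sup>+\<omega>. ennreal (exp (9 * \<rho> * d\<^sup>2)) + ennreal (exp (9 * \<rho> * (x \<omega>)\<^sup>2)) + \<Phi> \<omega> \<partial>M)"
    by (rule nn_integral_mono_AE)
  also have "\<dots> = ennreal (exp (9 * \<rho> * d\<^sup>2)) + (\<integral>\<^sup>+\<omega>. ennreal (exp (9 * \<rho> * (x \<omega>)\<^sup>2)) \<partial>M) + (\<integral>\<^sup>+\<omega>. \<Phi> \<omega> \<partial>M)"
    using x \<Phi>(1) by (simp add: nn_integral_add emeasure_space_1)
  finally show ?thesis .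
qed

lemma fbm_exp_sq_path_integral_majorant:
  fixes B :: "real \<Rightarrow> 'a \<Rightarrow> real ^ 'n" and \<kappa> :: real
  assumes P: "prob_space M" and fBm: "is_fBm H M B" and H: "0 < H" and T: "0 < T"
    and \<kappa>: "0 \<le> \<kappa>" "4 * (\<kappa> * T\<^sup>2) * CARD('n) * T powr (2 * H) \<le> 1"
  obtains \<Phi> where "\<Phi> \<in> borel_measurable M"
    and "AE \<omega> in M. ennreal (exp (\<kappa> * (integral {0..T} (\<lambda>r. norm (B r \<omega>)))\<^sup>2)) \<le> \<Phi> \<omega>"
    and "(\<integral>\<^sup>+\<omega>. \<Phi> \<omega> \<partial>M) \<le> 2 * of_nat CARD('n)"
proof (rule nn_integral_exp_sq_path_integral_le[OF T \<kappa>(1), of "\<lambda>r \<omega>. norm (B r \<omega>)" M])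
  show "(\<lambda>\<omega>. norm (B t \<omega>)) \<in> borel_measurable M" if "t \<in> {0..T}" for t
    using is_fBmD(1)[OF fBm] that by simp
  show "AE \<omega> in M. continuous_on {0..T} (\<lambda>t. norm (B t \<omega>))"
    using is_fBmD(2)[OF fBm]
    by (auto elim!: eventually_mono intro!: continuous_on_norm intro: continuous_on_subset)
  show "(\<integral>\<^sup>+\<omega>. ennreal (exp (\<kappa> * T\<^sup>2 * (norm (B t \<omega>))\<^sup>2)) \<partial>M) \<le> 2 * of_nat CARD('n)"
    if "t \<in> {0..T}" for t
    using fbm_nn_integral_exp_norm_sq_le[OF P fBm H that _ \<kappa>(2)] \<kappa>(1) T by simp
qed (rule that)

lemma fbm_exp_sq_moment_of_affine_bound:
  fixes B :: "real \<Rightarrow> 'a \<Rightarrow> real ^ 'n"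
  assumes P: "prob_space M" and fBm: "is_fBm H M B" and H: "0 < H" and T: "0 < T"
  obtains \<rho> where "0 < \<rho>"
    and "\<And>Z d t. t \<in> {0..T} \<Longrightarrow>
      (AE \<omega> in M. norm (Z \<omega>) \<le> d + E * norm (B t \<omega>) + F * integral {0..T} (\<lambda>r. norm (B r \<omega>))) \<Longrightarrow>
      (\<integral>\<^sup>+\<omega>. ennreal (exp (\<rho> * (norm (Z \<omega>))\<^sup>2)) \<partial>M) \<le> ennreal (exp (9 * \<rho> * d\<^sup>2)) + 4 * of_nat CARD('n)"
proof -
  define q where "q = E\<^sup>2 + F\<^sup>2 * T\<^sup>2 + 1"
  define \<rho> where "\<rho> = 1 / (36 * CARD('n) * T powr (2 * H) * q)"
  have q: "0 < q" "E\<^sup>2 \<le> q" "F\<^sup>2 * T\<^sup>2 \<le> q"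
    unfolding q_def by (auto intro!: add_nonneg_pos add_nonneg_nonneg)
  have \<rho>: "0 < \<rho>"
    using T q by (simp add: \<rho>_def)
  have \<kappa>E: "4 * (9 * \<rho> * E\<^sup>2) * CARD('n) * T powr (2 * H) \<le> 1"
    using T q by (simp add: \<rho>_def field_simps)
  have \<kappa>F: "4 * (9 * \<rho> * F\<^sup>2 * T\<^sup>2) * CARD('n) * T powr (2 * H) \<le> 1"
    using T q by (simp add: \<rho>_def field_simps)
  obtain \<Phi> where \<Phi>: "\<Phi> \<in> borel_measurable M"
    "AE \<omega> in M. ennreal (exp (9 * \<rho> * F\<^sup>2 * (integral {0..T} (\<lambda>r. norm (B r \<omega>)))\<^sup>2)) \<le> \<Phi> \<omega>"
    "(\<integral>\<^sup>+\<omega>. \<Phi> \<omega> \<partial>M) \<le> 2 * of_nat CARD('n)"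
    using fbm_exp_sq_path_integral_majorant[OF P fBm H T, of "9 * \<rho> * F\<^sup>2"] \<rho> \<kappa>F by auto
  show ?thesis
  proof (rule that[OF \<rho>])
    fix Z d t
    assume t: "t \<in> {0..T}"
      and bound: "AE \<omega> in M. norm (Z \<omega>) \<le> d + E * norm (B t \<omega>) + F * integral {0..T} (\<lambda>r. norm (B r \<omega>))"
    have "B t \<in> borel_measurable M"
      using is_fBmD(1)[OF fBm] t by simp
    then have "(\<integral>\<^sup>+\<omega>. ennreal (exp (\<rho> * (norm (Z \<omega>))\<^sup>2)) \<partial>M)
        \<le> ennreal (exp (9 * \<rho> * d\<^sup>2)) + (\<integral>\<^sup>+\<omega>. ennreal (exp (9 * \<rho> * E\<^sup>2 * (norm (B t \<omega>))\<^sup>2)) \<partial>M)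
          + (\<integral>\<^sup>+\<omega>. \<Phi> \<omega> \<partial>M)"
      using nn_integral_exp_sq_affine_le[OF P less_imp_le[OF \<rho>] bound _ _ \<Phi>(1)] \<Phi>(2)
      by (simp add: power_mult_distrib mult.assoc)
    also have "\<dots> \<le> ennreal (exp (9 * \<rho> * d\<^sup>2)) + 2 * of_nat CARD('n) + 2 * of_nat CARD('n)"
      using fbm_nn_integral_exp_norm_sq_le[OF P fBm H t _ \<kappa>E] \<rho> \<Phi>(3)
      by (intro add_mono) auto
    finally show "(\<integral>\<^sup>+\<omega>. ennreal (exp (\<rho> * (norm (Z \<omega>))\<^sup>2)) \<partial>M)
        \<le> ennreal (exp (9 * \<rho> * d\<^sup>2)) + 4 * of_nat CARD('n)"
      by (simp add: add.assoc flip: distrib_right)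
  qed
qed

theorem lemma5p3:
  fixes H :: real and \<sigma> :: "real ^ 'n ^ 'n" and b :: "real ^ 'n \<Rightarrow> real ^ 'n"
    and M :: "'a measure" and B :: "real \<Rightarrow> 'a \<Rightarrow> real ^ 'n"
    and Y :: "real ^ 'n \<Rightarrow> real \<Rightarrow> 'a \<Rightarrow> real ^ 'n" and K :: "(real ^ 'n) set"
  assumes H: "H \<in> {0<..<1/2} \<union> {1/2<..<1}"
    and inv: "invertible \<sigma>"
    and b_hoelder: "H > 1/2 \<Longrightarrow> \<exists>\<alpha> > 1 - 1/(2*H). \<exists>L. \<forall>y z. y \<noteq> z \<longrightarrow>
                       norm (b y - b z) \<le> L * norm (y - z) powr \<alpha>"
    and b_growth: "H < 1/2 \<Longrightarrow> b \<in> borel_measurable borel \<and> (\<exists>C. \<forall>y. norm (b y) \<le> C * (1 + norm y))"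
    and P: "prob_space M"
    and fBm: "is_fBm H M B"
    and sol: "\<And>y0. is_fSDE_solution M B b \<sigma> y0 (Y y0)"
    and K: "compact K"
    and T: "T > 0"
  shows "\<exists>\<rho>>0. (SUP y0\<in>K. SUP t\<in>{0..T}. \<integral>\<^sup>+ \<omega>. ennreal (exp (\<rho> * (norm (Y y0 t \<omega>))\<^sup>2)) \<partial>M) < \<infinity>"
proof -
  \<comment> \<open>Invertibility of \<sigma> and measurability of b are needed for existence of solutions,
    not for this estimate.\<close>
  have H0: "0 < H"
    using H by auto
  obtain C where C: "0 \<le> C" "\<And>y. norm (b y) \<le> C * (1 + norm y)"
    using drift_has_linear_growth[OF H b_hoelder] b_growth by blast
  obtain R where R: "\<And>y. y \<in> K \<Longrightarrow> norm y \<le> R"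
    using compact_imp_bounded[OF K] unfolding bounded_iff by blast
  define E where "E = onorm ((*v) \<sigma>)"
  obtain \<rho> where \<rho>: "0 < \<rho>" and moment: "\<And>(Z :: 'a \<Rightarrow> real ^ 'n) d t. t \<in> {0..T} \<Longrightarrow>
      (AE \<omega> in M. norm (Z \<omega>) \<le> d + E * norm (B t \<omega>) + C * exp (C * T) * E * integral {0..T} (\<lambda>r. norm (B r \<omega>))) \<Longrightarrow>
      (\<integral>\<^sup>+\<omega>. ennreal (exp (\<rho> * (norm (Z \<omega>))\<^sup>2)) \<partial>M) \<le> ennreal (exp (9 * \<rho> * d\<^sup>2)) + 4 * of_nat CARD('n)"
    using fbm_exp_sq_moment_of_affine_bound[OF P fBm H0 T] by blast
  define d where "d = (R + C * T) * (1 + C * exp (C * T) * T)"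
  have "(\<integral>\<^sup>+\<omega>. ennreal (exp (\<rho> * (norm (Y y0 t \<omega>))\<^sup>2)) \<partial>M) \<le> ennreal (exp (9 * \<rho> * d\<^sup>2)) + 4 * of_nat CARD('n)"
    if "y0 \<in> K" "t \<in> {0..T}" for y0 t
    using moment[OF that(2) fSDE_solution_norm_bound[OF fBm sol C that(2) R[OF that(1)], folded E_def]]
    unfolding d_def .
  then have "(SUP y0\<in>K. SUP t\<in>{0..T}. \<integral>\<^sup>+\<omega>. ennreal (exp (\<rho> * (norm (Y y0 t \<omega>))\<^sup>2)) \<partial>M)
      \<le> ennreal (exp (9 * \<rho> * d\<^sup>2)) + 4 * of_nat CARD('n)"
    by (intro SUP_least)
  also have "\<dots> < \<infinity>"
    by (simp add: ennreal_mult_less_top of_nat_less_top)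
  finally show ?thesis
    using \<rho> by blast
qed

end
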